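(* Let $f:\mathbb{R}^n\to\mathbb{R}$ be convex and $L$-smooth ($L>0$) with a minimizer $x^*$, let $0<s\le 1/L$, let $x_0\in\mathbb{R}^n$ be arbitrary and $v_0=x_0$. Let $(x_k)_{k\ge0}$, $(v_k)_{k\ge0}$ be generated by $$\begin{cases} x_{k+1}=x_k+\frac{2}{k}(v_k-x_{k+1})-s\nabla f(x_k),\\[2pt] v_{k+1}=v_k-\frac12 (ks)\nabla f(x_{k+1})-s\nabla f(x_{k+1}),\end{cases}$$ where for $k=0$ the first line is understood after multiplication by $k$, i.e. as $x_1=v_0$. Then for every $k\ge1$, $$\min_{0\le i\le k-1}\|\nabla f(x_i)\|^2\le\frac{12}{k^3s^2}\|x_0-x^*\|^2$$ and $$f(x_k)-f(x^* )\le\frac{2}{sk(k+2)}\|x_0-x^*\|^2.$$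
   Context: $\|\cdot\|$ is the Euclidean norm. A function $f$ is $L$-smooth if it is differentiable and $\|\nabla f(x)-\nabla f(y)\|\le L\|x-y\|$ for all $x,y\in\mathbb{R}^n$. It is assumed that the set of minimizers of $f$ is non-empty, and $x^*$ denotes an arbitrary minimizer. The recursion is implicit only linearly in $x_{k+1}$: its first line is equivalent to $(k+2)x_{k+1}=kx_k+2v_k-ks\nabla f(x_k)$. It is a form of Nesterov's accelerated gradient method. *)

theory Defs
  imports "HOL-Analysis.Analysis"
begin

definition grad :: "('a::real_inner \<Rightarrow> real) \<Rightarrow> 'a \<Rightarrow> 'a" where
  "grad f x = (THE D. GDERIV f x :> D)"

lemma grad_eqI:
  assumes "GDERIV f x :> D"
  shows "grad f x = D"
proof -
  have "E = D" if "GDERIV f x :> E" for E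
  proof -
    have "(\<lambda>h. h \<bullet> E) = (\<lambda>h. h \<bullet> D)"
      using that assms has_derivative_unique unfolding gderiv_def by blast
    then show ?thesis
      by (metis inner_commute vector_eq_rdot)
  qed
  with assms show ?thesis
    unfolding grad_def by blast
qed

lemma GDERIV_grad:
  fixes f :: "'a::euclidean_space \<Rightarrow> real"
  assumes "f differentiable (at x)"
  shows "GDERIV f x :> grad f x"
proof -
  from assms obtain f' where f': "(f has_derivative f') (at x)"
    unfolding differentiable_def by blast
  then have lin: "linear f'"
    by (rule has_derivative_linear)
  have "f' h = h \<bullet> (\<Sum>b\<in>Basis. f' b *\<^sub>R b)" for h
  proof -
    have "f' h = f' (\<Sum>b\<in>Basis. (h \<bullet> b) *\<^sub>R b)"
      by (simp add: euclidean_representation)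
    also have "\<dots> = h \<bullet> (\<Sum>b\<in>Basis. f' b *\<^sub>R b)"
      using lin by (simp add: linear_sum linear_cmul inner_sum_right mult.commute)
    finally show ?thesis .
  qed
  then have "f' = (\<lambda>h. h \<bullet> (\<Sum>b\<in>Basis. f' b *\<^sub>R b))"
    by blast
  with f' have "GDERIV f x :> (\<Sum>b\<in>Basis. f' b *\<^sub>R b)"
    unfolding gderiv_def by simp
  then show ?thesis
    using grad_eqI by metis
qed

definition L_smooth :: "real \<Rightarrow> ('a::real_inner \<Rightarrow> real) \<Rightarrow> bool" where
  "L_smooth L f \<longleftrightarrow>
     (\<forall>x. f differentiable (at x)) \<and>
     (\<forall>x y. norm (grad f x - grad f y) \<le> L * norm (x - y))"

end

theory Submission
  imports Defs
begin

text \<open>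
  Write \<open>g\<^sub>k\<close> for the gradient at \<open>x\<^sub>k\<close> and \<open>\<delta>\<^sub>k = f x\<^sub>k - f x\<^sup>*\<close>. Both rates come from a single
  potential, \<open>E\<^sub>k = s/2 (k+1)\<^sup>2 \<delta>\<^sub>k + \<parallel>v\<^sub>k - x\<^sup>*\<parallel>\<^sup>2\<close>.

  For a convex function with Lipschitz gradient, the tangent inequality can be sharpened by a
  multiple of the squared difference of the two gradients (\<open>convex_smooth_interpolation\<close>). Take this
  inequality at the new iterate \<open>x\<^sub>k\<^sub>+\<^sub>1\<close>, once against \<open>x\<^sub>k\<close> with weight \<open>k\<close> and once against \<open>x\<^sup>*\<close>
  with weight \<open>2\<close>. The recursion says that these weights turn the linear terms into
  \<open>2 g\<^sub>k\<^sub>+\<^sub>1 \<bullet> (v\<^sub>k - x\<^sup>*)\<close> up to a multiple of \<open>g\<^sub>k\<^sub>+\<^sub>1 \<bullet> g\<^sub>k\<close>, which the squared difference of gradients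
  absorbs. Expanding \<open>\<parallel>v\<^sub>k\<^sub>+\<^sub>1 - x\<^sup>*\<parallel>\<^sup>2\<close> produces the same inner product with the opposite sign, and the
  terms in \<open>\<parallel>g\<^sub>k\<^sub>+\<^sub>1\<parallel>\<^sup>2\<close> cancel exactly. The outcome (\<open>accelerated_step\<close>) is
  \<open>E\<^sub>k\<^sub>+\<^sub>1 \<le> E\<^sub>k - s/2 \<delta>\<^sub>k - s\<^sup>2/4 k(k+2) \<parallel>g\<^sub>k\<parallel>\<^sup>2\<close>.

  One gradient step decreases \<open>f\<close> by at least \<open>s/2 \<parallel>g\<^sub>k\<parallel>\<^sup>2\<close>, so \<open>\<delta>\<^sub>k \<ge> s/2 \<parallel>g\<^sub>k\<parallel>\<^sup>2\<close>, and each step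
  lowers the potential by at least \<open>s\<^sup>2/4 (k+1)\<^sup>2 \<parallel>g\<^sub>k\<parallel>\<^sup>2\<close>. Since \<open>E\<^sub>1 \<le> \<parallel>x\<^sub>0 - x\<^sup>*\<parallel>\<^sup>2\<close> and the
  potential stays nonnegative, the function values decay like \<open>1/k\<^sup>2\<close>. The squared gradient
  norms, weighted by \<open>(i+1)\<^sup>2\<close>, have a bounded sum; the weights add up to order \<open>k\<^sup>3\<close>, which gives
  the rate of the smallest gradient.
\<close>

section \<open>Convex functions with Lipschitz gradient\<close>

lemma grad_line_derivative:
  fixes f :: "'a::euclidean_space \<Rightarrow> real"
  assumes "L_smooth L f"
  shows "((\<lambda>t. f (a + t *\<^sub>R d)) has_real_derivative grad f (a + t *\<^sub>R d) \<bullet> d) (at t within S)"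
proof -
  have "(f has_derivative (\<lambda>h. h \<bullet> grad f (a + t *\<^sub>R d))) (at (a + t *\<^sub>R d))"
    using GDERIV_grad assms unfolding L_smooth_def gderiv_def by blast
  moreover have "((\<lambda>t. a + t *\<^sub>R d) has_derivative (\<lambda>h. h *\<^sub>R d)) (at t within S)"
    by (auto intro!: derivative_eq_intros)
  ultimately have "((\<lambda>t. f (a + t *\<^sub>R d)) has_derivative (\<lambda>h. h *\<^sub>R d \<bullet> grad f (a + t *\<^sub>R d)))
      (at t within S)"
    using has_derivative_compose by blast
  then show ?thesis
    unfolding has_field_derivative_def
    by (rule has_derivative_eq_rhs) (auto simp: inner_commute mult.commute)
qed

lemma convex_above_tangent:
  fixes f :: "'a::euclidean_space \<Rightarrow> real"
  assumes "convex_on UNIV f" and "L_smooth L f"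
  shows "f a + grad f a \<bullet> (b - a) \<le> f b"
proof -
  let ?h = "\<lambda>t. f (a + t *\<^sub>R (b - a))"
  have "convex_on UNIV ?h"
  proof (rule convex_onI)
    fix t p q :: real
    assume t: "0 < t" "t < 1"
    have "a + ((1 - t) *\<^sub>R p + t *\<^sub>R q) *\<^sub>R (b - a)
        = (1 - t) *\<^sub>R (a + p *\<^sub>R (b - a)) + t *\<^sub>R (a + q *\<^sub>R (b - a))"
      by (simp add: algebra_simps)
    then show "?h ((1 - t) *\<^sub>R p + t *\<^sub>R q) \<le> (1 - t) * ?h p + t * ?h q"
      using convex_onD[OF assms(1), of t] t by simp
  qed simp
  moreover have "(?h has_real_derivative grad f a \<bullet> (b - a)) (at 0 within UNIV)"
    using grad_line_derivative[OF assms(2), where t = 0] by simp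
  ultimately have "grad f a \<bullet> (b - a) * (1 - 0) \<le> ?h 1 - ?h 0"
    by (intro convex_on_imp_above_tangent[where A = UNIV]) auto
  then show ?thesis by simp
qed

text \<open>
  Along a segment the slope of \<open>f\<close> exceeds its initial value by at most \<open>L\<close> times the distance
  covered times the length of the segment, so the function minus the quadratic on the right is
  nonincreasing there.
\<close>

lemma smooth_below_quadratic:
  fixes f :: "'a::euclidean_space \<Rightarrow> real"
  assumes "L_smooth L f"
  shows "f b \<le> f a + grad f a \<bullet> (b - a) + L / 2 * (norm (b - a))\<^sup>2"
proof -
  let ?d = "b - a"
  let ?h = "\<lambda>t. f (a + t *\<^sub>R ?d) - t * (grad f a \<bullet> ?d) - L / 2 * t\<^sup>2 * (norm ?d)\<^sup>2"
  have "?h 1 \<le> ?h 0"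
  proof (rule DERIV_nonpos_imp_nonincreasing[where f = ?h])
    fix t :: real
    assume t: "0 \<le> t" "t \<le> 1"
    let ?D = "grad f (a + t *\<^sub>R ?d) \<bullet> ?d - grad f a \<bullet> ?d - L * t * (norm ?d)\<^sup>2"
    have "(?h has_real_derivative ?D) (at t)"
      by (auto intro!: derivative_eq_intros grad_line_derivative[OF assms])
    moreover have "?D \<le> 0"
    proof -
      have "grad f (a + t *\<^sub>R ?d) \<bullet> ?d - grad f a \<bullet> ?d
          \<le> norm (grad f (a + t *\<^sub>R ?d) - grad f a) * norm ?d"
        by (metis inner_diff_left norm_cauchy_schwarz)
      also have "\<dots> \<le> L * norm (a + t *\<^sub>R ?d - a) * norm ?d"
        using assms unfolding L_smooth_def by (intro mult_right_mono norm_ge_zero) blast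
      also have "\<dots> = L * t * (norm ?d)\<^sup>2"
        using t by (simp add: power2_eq_square)
      finally show ?thesis by simp
    qed
    ultimately show "\<exists>D. (?h has_real_derivative D) (at t) \<and> D \<le> 0"
      by blast
  qed simp
  then show ?thesis by simp
qed

text \<open>
  A step of length \<open>s\<close> along any direction \<open>d\<close> costs a quadratic term of at most \<open>s/2 \<parallel>d\<parallel>\<^sup>2\<close>,
  because \<open>L s \<le> 1\<close>. The free direction lets the lemma serve both the plain gradient step and the
  step along a difference of gradients.
\<close>

lemma smooth_short_step:
  fixes f :: "'a::euclidean_space \<Rightarrow> real"
  assumes "L_smooth L f" and "0 < L" and "0 < s" and "s \<le> 1 / L"
  shows "f (a - s *\<^sub>R d) \<le> f a - s * (grad f a \<bullet> d) + s / 2 * (norm d)\<^sup>2"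
proof -
  have "L * s \<le> 1"
    using assms by (simp add: field_simps)
  then have "L / 2 * s\<^sup>2 \<le> s / 2"
    using mult_right_mono[of "L * s" 1 s] assms(3) by (simp add: power2_eq_square)
  then have "L / 2 * s\<^sup>2 * (norm d)\<^sup>2 \<le> s / 2 * (norm d)\<^sup>2"
    by (rule mult_right_mono) simp
  then show ?thesis
    using smooth_below_quadratic[OF assms(1), of "a - s *\<^sub>R d" a]
    by (simp add: power_mult_distrib)
qed

lemma gradient_step_bound:
  fixes f :: "'a::euclidean_space \<Rightarrow> real"
  assumes "L_smooth L f" and "0 < L" and "0 < s" and "s \<le> 1 / L"
    and "\<forall>y. f z \<le> f y"
  shows "s / 2 * (norm (grad f a))\<^sup>2 \<le> f a - f z"
  using smooth_short_step[OF assms(1-4), of a "grad f a"]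
    assms(5)[rule_format, of "a - s *\<^sub>R grad f a"]
  by (simp add: power2_norm_eq_inner)

text \<open>
  The sharpened tangent inequality compares two bounds on \<open>f\<close> at one auxiliary point, obtained from
  \<open>b\<close> by a step along the difference of the gradients: the tangent at \<open>a\<close> bounds \<open>f\<close> from below
  there, and the short step from \<open>b\<close> bounds it from above.
\<close>

lemma convex_smooth_interpolation:
  fixes f :: "'a::euclidean_space \<Rightarrow> real"
  assumes "convex_on UNIV f" and "L_smooth L f" and "0 < L" and "0 < s" and "s \<le> 1 / L"
  shows "f a \<le> f b + grad f a \<bullet> (a - b) - s / 2 * (norm (grad f a - grad f b))\<^sup>2"
proof -
  let ?d = "grad f b - grad f a"
  have "f a + grad f a \<bullet> (b - s *\<^sub>R ?d - a) \<le> f (b - s *\<^sub>R ?d)"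
    using assms(1,2) by (rule convex_above_tangent)
  also have "\<dots> \<le> f b - s * (grad f b \<bullet> ?d) + s / 2 * (norm ?d)\<^sup>2"
    using assms(2-5) by (rule smooth_short_step)
  finally have "f a \<le> f b + grad f a \<bullet> (a - b) - s * (?d \<bullet> ?d) + s / 2 * (norm ?d)\<^sup>2"
    by (simp add: algebra_simps)
  then show ?thesis
    by (simp add: power2_norm_eq_inner[symmetric] norm_minus_commute)
qed

section \<open>Decrease of the potential\<close>

text \<open>
  The coefficient of \<open>f p - f z\<close> on the right is \<open>s/2 k(k+2) = s/2 ((k+1)\<^sup>2 - 1)\<close>, smaller by
  \<open>s/2\<close> than the one that the potential carries. The form with \<open>k(k+2)\<close> also covers \<open>k = 0\<close>, where the previous
  iterate drops out and the step starts from the distance term alone.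
\<close>

lemma accelerated_step:
  fixes f :: "'a::euclidean_space \<Rightarrow> real"
  assumes smooth: "convex_on UNIV f" "L_smooth L f" "0 < L" "0 < s" "s \<le> 1 / L"
    and minimizer: "\<forall>y. f z \<le> f y"
    and "0 \<le> k"
    and x_step: "(k + 2) *\<^sub>R q = k *\<^sub>R p + 2 *\<^sub>R u - (k * s) *\<^sub>R grad f p"
    and v_step: "w = u - ((k + 2) * s / 2) *\<^sub>R grad f q"
  shows "s / 2 * (k + 2)\<^sup>2 * (f q - f z) + (norm (w - z))\<^sup>2
    \<le> s / 2 * (k * (k + 2)) * (f p - f z) - s\<^sup>2 / 4 * (k * (k + 2)) * (norm (grad f p))\<^sup>2
      + (norm (u - z))\<^sup>2"
proof -
  let ?g = "grad f q" and ?h = "grad f p"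
  have "grad f z = 0"
    using gradient_step_bound[OF smooth(2-5) minimizer, of z] \<open>0 < s\<close>
    by (simp add: mult_le_0_iff)
  then have to_minimizer: "f q \<le> f z + ?g \<bullet> (q - z) - s / 2 * (norm ?g)\<^sup>2"
    using convex_smooth_interpolation[OF smooth, of q z] by simp
  have to_previous:
    "f q \<le> f p + ?g \<bullet> (q - p) - s / 2 * ((norm ?g)\<^sup>2 - 2 * (?g \<bullet> ?h) + (norm ?h)\<^sup>2)"
  proof -
    have "(norm (?g - ?h))\<^sup>2 = (norm ?g)\<^sup>2 - 2 * (?g \<bullet> ?h) + (norm ?h)\<^sup>2"
      by (simp add: power2_norm_eq_inner inner_diff_left inner_diff_right inner_commute)
    then show ?thesis
      using convex_smooth_interpolation[OF smooth, of q p] by simp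
  qed
  have "?g \<bullet> ((k + 2) *\<^sub>R q) = ?g \<bullet> (k *\<^sub>R p + 2 *\<^sub>R u - (k * s) *\<^sub>R ?h)"
    using x_step by simp
  then have linear_terms:
    "k * (?g \<bullet> (q - p)) + 2 * (?g \<bullet> (q - z)) = 2 * (?g \<bullet> (u - z)) - k * s * (?g \<bullet> ?h)"
    by (simp add: inner_diff_right inner_add_right algebra_simps)
  have "k * f q + 2 * f q
    \<le> k * (f p + ?g \<bullet> (q - p) - s / 2 * ((norm ?g)\<^sup>2 - 2 * (?g \<bullet> ?h) + (norm ?h)\<^sup>2))
      + 2 * (f z + ?g \<bullet> (q - z) - s / 2 * (norm ?g)\<^sup>2)"
    by (intro add_mono mult_left_mono to_previous to_minimizer \<open>0 \<le> k\<close>) simp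
  also have "\<dots> = k * f p + 2 * f z + 2 * (?g \<bullet> (u - z))
      - s / 2 * (k + 2) * (norm ?g)\<^sup>2 - s / 2 * k * (norm ?h)\<^sup>2"
    using linear_terms by (simp add: algebra_simps)
  finally have "(k + 2) * (f q - f z) \<le> k * (f p - f z) + 2 * (?g \<bullet> (u - z))
      - s / 2 * (k + 2) * (norm ?g)\<^sup>2 - s / 2 * k * (norm ?h)\<^sup>2"
    by (simp add: algebra_simps)
  then have "(k + 2) * s / 2 * ((k + 2) * (f q - f z))
    \<le> (k + 2) * s / 2 * (k * (f p - f z) + 2 * (?g \<bullet> (u - z))
      - s / 2 * (k + 2) * (norm ?g)\<^sup>2 - s / 2 * k * (norm ?h)\<^sup>2)"
    using \<open>0 \<le> k\<close> \<open>0 < s\<close> by (intro mult_left_mono) auto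
  moreover have "(norm (w - z))\<^sup>2
    = (norm (u - z))\<^sup>2 - (k + 2) * s * (?g \<bullet> (u - z)) + ((k + 2) * s / 2)\<^sup>2 * (norm ?g)\<^sup>2"
  proof -
    have "w - z = (u - z) - ((k + 2) * s / 2) *\<^sub>R ?g"
      using v_step by simp
    also have "(norm \<dots>)\<^sup>2
      = (norm (u - z))\<^sup>2 - 2 * ((k + 2) * s / 2) * (?g \<bullet> (u - z))
        + ((k + 2) * s / 2)\<^sup>2 * (norm ?g)\<^sup>2"
      unfolding power2_norm_eq_inner inner_diff_left[of "u - z"] inner_diff_right[of _ "u - z"]
      by (simp add: inner_commute power2_eq_square del: inner_diff_left inner_diff_right)
    finally show ?thesis by simp
  qed
  ultimately show ?thesis
    by (simp add: power2_eq_square field_simps)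
qed

section \<open>Convergence rates\<close>

text \<open>
  Passing from \<open>k\<close> to \<open>k + 1\<close> adds \<open>(k+1)\<^sup>2\<close> to the sum and only \<open>k\<^sup>2 + k + 1/3\<close> to \<open>k\<^sup>3/3\<close>. The inequality
  fails at \<open>k = 1\<close>, where the sum is empty, so the first iterate needs its own argument below.
\<close>

lemma sum_shifted_squares_ge:
  assumes "2 \<le> k"
  shows "real k ^ 3 / 3 \<le> (\<Sum>i=1..k-1. (real i + 1)\<^sup>2)"
  using assms
proof (induction k rule: dec_induct)
  case base
  show ?case by simp
next
  case (step k)
  have "{1..Suc k - 1} = insert k {1..k-1}"
    using step.hyps by auto
  moreover have "k \<notin> {1..k-1}"
    using step.hyps by auto
  ultimately have "(\<Sum>i=1..Suc k - 1. (real i + 1)\<^sup>2)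
      = (real k + 1)\<^sup>2 + (\<Sum>i=1..k-1. (real i + 1)\<^sup>2)"
    by simp
  moreover have "real (Suc k) ^ 3 / 3 \<le> real k ^ 3 / 3 + (real k + 1)\<^sup>2"
    by (simp add: power3_eq_cube power2_eq_square field_simps)
  ultimately show ?case
    using step.IH by linarith
qed

theorem theorem3p1:
  fixes f :: "real ^ 'n \<Rightarrow> real"
    and L s :: real
    and x v :: "nat \<Rightarrow> real ^ 'n"
    and xstar :: "real ^ 'n"
  assumes "convex_on UNIV f"
    and "L > 0"
    and "L_smooth L f"
    and "\<forall>y. f xstar \<le> f y"
    and "0 < s" and "s \<le> 1 / L"
    and "v 0 = x 0"
    and "x 1 = v 0"
    and "\<forall>k\<ge>1. x (k + 1) =
           x k + (2 / real k) *\<^sub>R (v k - x (k + 1)) - s *\<^sub>R grad f (x k)"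
    and "\<forall>k. v (k + 1) =
           v k - (1 / 2 * (real k * s)) *\<^sub>R grad f (x (k + 1)) - s *\<^sub>R grad f (x (k + 1))"
  shows "\<forall>k\<ge>1.
           (MIN i\<in>{0..k - 1}. (norm (grad f (x i)))\<^sup>2)
             \<le> 12 / (real k ^ 3 * s\<^sup>2) * (norm (x 0 - xstar))\<^sup>2
         \<and> f (x k) - f xstar \<le> 2 / (s * real k * (real k + 2)) * (norm (x 0 - xstar))\<^sup>2"
proof -
  define \<delta> where "\<delta> k = f (x k) - f xstar" for k
  define G where "G k = (norm (grad f (x k)))\<^sup>2" for k
  define D where "D k = (norm (v k - xstar))\<^sup>2" for k
  define E where "E k = s / 2 * (real k + 1)\<^sup>2 * \<delta> k + D k" for k
  note smooth = assms(1,3,2,5,6)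
  have D0: "D 0 = (norm (x 0 - xstar))\<^sup>2"
    using assms(7) by (simp add: D_def)
  have G_nonneg: "0 \<le> G k" and D_nonneg: "0 \<le> D k" for k
    by (simp_all add: G_def D_def)
  have gap: "s / 2 * G k \<le> \<delta> k" for k
    unfolding G_def \<delta>_def using gradient_step_bound[OF smooth(2-5) assms(4)] .

  have step: "s / 2 * (real k + 2)\<^sup>2 * \<delta> (k + 1) + D (k + 1)
    \<le> s / 2 * (real k * (real k + 2)) * \<delta> k - s\<^sup>2 / 4 * (real k * (real k + 2)) * G k + D k" for k
    unfolding \<delta>_def G_def D_def
  proof (rule accelerated_step[OF smooth assms(4)])
    show "(real k + 2) *\<^sub>R x (k + 1) = real k *\<^sub>R x k + 2 *\<^sub>R v k - (real k * s) *\<^sub>R grad f (x k)"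
    proof (cases "k = 0")
      case True
      then show ?thesis using assms(8) by simp
    next
      case False
      then have "real k *\<^sub>R x (k + 1)
          = real k *\<^sub>R (x k + (2 / real k) *\<^sub>R (v k - x (k + 1)) - s *\<^sub>R grad f (x k))"
        using assms(9) by (metis One_nat_def Suc_leI neq0_conv)
      also have "\<dots> = real k *\<^sub>R x k + 2 *\<^sub>R (v k - x (k + 1)) - (real k * s) *\<^sub>R grad f (x k)"
        using False by (simp add: scaleR_add_right scaleR_diff_right)
      finally show ?thesis
        by (simp add: algebra_simps)
    qed
    have "v (k + 1) = v k - (1 / 2 * (real k * s)) *\<^sub>R grad f (x (k + 1)) - s *\<^sub>R grad f (x (k + 1))"
      using assms(10) by blast
    also have "\<dots> = v k - (1 / 2 * (real k * s) + s) *\<^sub>R grad f (x (k + 1))"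
      by (simp only: scaleR_add_left diff_diff_eq)
    also have "1 / 2 * (real k * s) + s = (real k + 2) * s / 2"
      by (simp add: field_simps)
    finally show "v (k + 1) = v k - ((real k + 2) * s / 2) *\<^sub>R grad f (x (k + 1))" .
  qed simp
  have decrease: "s\<^sup>2 / 4 * ((real k + 1)\<^sup>2 * G k) + E (k + 1) \<le> E k" for k
  proof -
    have "s / 2 * (s / 2 * G k) \<le> s / 2 * \<delta> k"
      using gap \<open>0 < s\<close> by (intro mult_left_mono) auto
    then show ?thesis
      using step[of k] by (simp add: E_def power2_eq_square field_simps)
  qed
  (* The k = 0 instance of the step bound has no \<delta> 0 term, so the chain starts from D 0, not E 0. *)
  have telescoped: "s\<^sup>2 / 4 * (\<Sum>i=1..<k. (real i + 1)\<^sup>2 * G i) + E k \<le> D 0" if "1 \<le> k" for k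
    using that
  proof (induction k rule: dec_induct)
    case base
    show ?case using step[of 0] by (simp add: E_def)
  next
    case (step k)
    then show ?case
      using decrease[of k] by (simp add: algebra_simps)
  qed
  have weighted: "s\<^sup>2 / 4 * (\<Sum>i=1..k. (real i + 1)\<^sup>2 * G i) \<le> D 0" if "1 \<le> k" for k
  proof -
    have "0 \<le> E (k + 1)"
    proof -
      have "0 \<le> s / 2 * G (k + 1)"
        using G_nonneg \<open>0 < s\<close> by simp
      then have "0 \<le> \<delta> (k + 1)"
        using gap order_trans by blast
      then show ?thesis
        unfolding E_def using \<open>0 < s\<close> D_nonneg by simp
    qed
    then show ?thesis
      using telescoped[of "k + 1"] by (simp add: atLeastLessThanSuc_atLeastAtMost)
  qed

  show ?thesis
  proof (intro allI impI conjI)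
    fix k :: nat
    assume k: "1 \<le> k"
    define m where "m = (MIN i\<in>{0..k - 1}. G i)"
    have m_le: "m \<le> G i" if "i \<le> k - 1" for i
      unfolding m_def using that by (intro Min_le) auto
    have m_nonneg: "0 \<le> m"
      unfolding m_def using G_nonneg by (subst Min_ge_iff) auto
    have "s\<^sup>2 / 4 * (real k ^ 3 / 3 * m) \<le> D 0"
    proof (cases "k = 1")
      case True
      (* The minimum runs over x 0 alone; the weighted sum starts at x 1, which is the same point. *)
      have "m \<le> G 1"
        using m_le[of 0] assms(7,8) by (simp add: G_def)
      then have "1 / 3 * m \<le> 4 * G 1"
        using m_nonneg by linarith
      then have "s\<^sup>2 / 4 * (1 / 3 * m) \<le> s\<^sup>2 / 4 * (4 * G 1)"
        by (rule mult_left_mono) simp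
      then show ?thesis
        using weighted[of 1] True by simp
    next
      case False
      then have k2: "2 \<le> k" using k by simp
      have "real k ^ 3 / 3 * m \<le> (\<Sum>i=1..k-1. (real i + 1)\<^sup>2) * m"
        using sum_shifted_squares_ge[OF k2] m_nonneg by (rule mult_right_mono)
      also have "\<dots> \<le> (\<Sum>i=1..k-1. (real i + 1)\<^sup>2 * G i)"
        unfolding sum_distrib_right by (intro sum_mono mult_left_mono m_le) auto
      finally have "s\<^sup>2 / 4 * (real k ^ 3 / 3 * m)
          \<le> s\<^sup>2 / 4 * (\<Sum>i=1..k-1. (real i + 1)\<^sup>2 * G i)"
        by (rule mult_left_mono) simp
      then show ?thesis
        using weighted[of "k - 1"] k2 by linarith
    qed
    then have "m \<le> 12 / (real k ^ 3 * s\<^sup>2) * D 0"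
      using k \<open>0 < s\<close> by (simp add: field_simps)
    then show "(MIN i\<in>{0..k - 1}. (norm (grad f (x i)))\<^sup>2)
        \<le> 12 / (real k ^ 3 * s\<^sup>2) * (norm (x 0 - xstar))\<^sup>2"
      unfolding m_def G_def D0 .

    have \<delta>_nonneg: "0 \<le> \<delta> k"
      using assms(4) by (simp add: \<delta>_def)
    have "s / 2 * (real k * (real k + 2)) * \<delta> k \<le> s / 2 * (real k + 1)\<^sup>2 * \<delta> k"
      using \<delta>_nonneg \<open>0 < s\<close>
      by (intro mult_right_mono mult_left_mono) (auto simp: power2_eq_square algebra_simps)
    also have "\<dots> \<le> E k"
      using D_nonneg by (simp add: E_def)
    also have "\<dots> \<le> D 0"
    proof -
      have "0 \<le> s\<^sup>2 / 4 * (\<Sum>i=1..<k. (real i + 1)\<^sup>2 * G i)"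
        using G_nonneg by (intro mult_nonneg_nonneg sum_nonneg) auto
      then show ?thesis
        using telescoped[OF k] by linarith
    qed
    finally have "\<delta> k * (s * real k * (real k + 2)) \<le> 2 * D 0"
      by (simp add: algebra_simps)
    then have "\<delta> k \<le> 2 * D 0 / (s * real k * (real k + 2))"
      using k \<open>0 < s\<close> by (subst pos_le_divide_eq) auto
    then have "\<delta> k \<le> 2 / (s * real k * (real k + 2)) * D 0"
      by simp
    then show "f (x k) - f xstar \<le> 2 / (s * real k * (real k + 2)) * (norm (x 0 - xstar))\<^sup>2"
      unfolding \<delta>_def D0 .
  qed
qed

end
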